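(* Let $1<p<\infty$ and $\theta\in\mathcal{A}_p$. A holomorphic function $g$ on $\mathbb{B}$ is a pointwise multiplier of $H^p(\theta)$ if and only if $g\in H^\infty$.
   Context: $n>1$; $\mathbb{B}$ is the unit ball of $\mathbb{C}^n$, $\mathbb{S}$ its boundary, $d\sigma$ Lebesgue measure on $\mathbb{S}$; $z\bar w=\sum_j z_j\bar w_j$. For $z=|z|\zeta\in\mathbb{B}\setminus\{0\}$, $\zeta\in\mathbb{S}$, let $I_z=\{\eta\in\mathbb{S}:|1-\eta\bar\zeta|<1-|z|^2\}$; $|A|$ is the Lebesgue measure of $A$. $\mathcal{A}_p$ is the class of non-negative weights $\theta\in L^1(d\sigma)$ with $\sup_{z}\left(\frac{1}{|I_z|}\int_{I_z}\theta\,d\sigma\right)^{1/p}\left(\frac{1}{|I_z|}\int_{I_z}\theta^{-p'/p}\,d\sigma\right)^{1/p'}<\infty$, $1/p+1/p'=1$. $H^p(\theta)$ is the space of holomorphic $f$ on $\mathbb{B}$ with $\|f\|_{H^p(\theta)}=\left(\sup_{0<r<1}\int_{\mathbb{S}}|f(r\zeta)|^p\theta(\zeta)\,d\sigma(\zeta)\right)^{1/p}<\infty$. $H^\infty$ is the space of bounded holomorphic functions on $\mathbb{B}$. A function $g$ is a pointwise multiplier of a space $X$ if $f\mapsto gf$ maps $X$ (boundedly) to itself. *)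

theory Defs
  imports "HOL-Analysis.Analysis"
begin

text \<open>The library has no surface measure. Here \<open>\<sigma>(A)\<close> is \<open>d\<close> times the volume of the cone
  \<open>{r\<zeta> : 0 < r < 1, \<zeta> \<in> A}\<close>, where \<open>d\<close> is the real dimension. This is the normalisation for
  which integration in polar coordinates reads
  \<open>\<integral> f dx = \<integral>\<^sub>0\<^sup>\<infinity> r\<^sup>d\<^sup>-\<^sup>1 \<integral> f(r\<zeta>) d\<sigma>(\<zeta>) dr\<close>. For \<open>x \<noteq> 0\<close>, \<open>sgn x\<close> is \<open>x\<close> divided by its norm.\<close>

definition sphere_measure :: "'a::euclidean_space measure" where
  "sphere_measure =
     completion (scale_measure (of_nat DIM('a))
       (distr (restrict_space lborel (ball 0 1 - {0})) (restrict_space borel (sphere 0 1)) sgn))"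

definition herm :: "complex ^ 'n \<Rightarrow> complex ^ 'n \<Rightarrow> complex" where
  "herm z w = (\<Sum>j\<in>UNIV. z $ j * cnj (w $ j))"

text \<open>Only used for \<open>z \<noteq> 0\<close>; the set is empty for \<open>z = 0\<close> because \<open>sgn 0 = 0\<close>.\<close>

definition nonisotropic_ball :: "complex ^ 'n \<Rightarrow> (complex ^ 'n) set" where
  "nonisotropic_ball z = {\<eta> \<in> sphere 0 1. norm (1 - herm \<eta> (sgn z)) < 1 - (norm z)\<^sup>2}"

text \<open>Real powers with values in \<open>[0, \<infinity>]\<close>. In contrast to \<open>powr\<close> on the reals, a negative power
  of \<open>0\<close> is \<open>\<infinity>\<close>, so that \<open>\<theta>\<^sup>-\<^sup>p\<^sup>'\<^sup>/\<^sup>p\<close> is infinite where \<open>\<theta>\<close> vanishes.\<close>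

definition ennreal_powr :: "ennreal \<Rightarrow> real \<Rightarrow> ennreal" where
  "ennreal_powr x a =
     (if a = 0 then 1
      else if x = 0 then (if a < 0 then top else 0)
      else if x = top then (if a < 0 then 0 else top)
      else ennreal (enn2real x powr a))"

definition conj_exponent :: "real \<Rightarrow> real" where
  "conj_exponent p = p / (p - 1)"

definition sphere_average :: "(complex ^ 'n) set \<Rightarrow> (complex ^ 'n \<Rightarrow> ennreal) \<Rightarrow> ennreal" where
  "sphere_average A h = (\<integral>\<^sup>+\<eta>\<in>A. h \<eta> \<partial>sphere_measure) / emeasure sphere_measure A"

text \<open>The weight that vanishes almost everywhere is excluded explicitly: for it the product in the
  supremum is \<open>0 \<cdot> \<infinity>\<close>, which is \<open>0\<close> in \<^typ>\<open>ennreal\<close>.\<close>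

definition Ap_weight :: "real \<Rightarrow> (complex ^ 'n \<Rightarrow> real) \<Rightarrow> bool" where
  "Ap_weight p \<theta> \<longleftrightarrow>
     (\<forall>\<eta>\<in>sphere 0 1. 0 \<le> \<theta> \<eta>) \<and>
     integrable sphere_measure \<theta> \<and>
     \<not> (AE \<eta> in sphere_measure. \<theta> \<eta> = 0) \<and>
     (SUP z \<in> ball 0 1 - {0}.
        ennreal_powr (sphere_average (nonisotropic_ball z) (\<lambda>\<eta>. ennreal (\<theta> \<eta>))) (1 / p) *
        ennreal_powr (sphere_average (nonisotropic_ball z)
          (\<lambda>\<eta>. ennreal_powr (ennreal (\<theta> \<eta>)) (- conj_exponent p / p))) (1 / conj_exponent p)) < top"

definition holomorphic_Cn_on :: "(complex ^ 'n \<Rightarrow> complex) \<Rightarrow> (complex ^ 'n) set \<Rightarrow> bool" where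
  "holomorphic_Cn_on f U \<longleftrightarrow>
     (\<forall>z\<in>U. \<exists>D. (f has_derivative D) (at z) \<and> (\<forall>c v. D (c *s v) = c * D v))"

definition hardy_sup :: "real \<Rightarrow> (complex ^ 'n \<Rightarrow> real) \<Rightarrow> (complex ^ 'n \<Rightarrow> complex) \<Rightarrow> ennreal" where
  "hardy_sup p \<theta> f =
     (SUP r \<in> {0<..<1::real}.
        \<integral>\<^sup>+\<zeta>. ennreal (norm (f (r *\<^sub>R \<zeta>)) powr p * \<theta> \<zeta>) \<partial>sphere_measure)"

definition hardy_norm :: "real \<Rightarrow> (complex ^ 'n \<Rightarrow> real) \<Rightarrow> (complex ^ 'n \<Rightarrow> complex) \<Rightarrow> ennreal" where
  "hardy_norm p \<theta> f = ennreal_powr (hardy_sup p \<theta> f) (1 / p)"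

text \<open>Members are total functions; only their values on the open unit ball matter.\<close>

definition hardy_space :: "real \<Rightarrow> (complex ^ 'n \<Rightarrow> real) \<Rightarrow> (complex ^ 'n \<Rightarrow> complex) set" where
  "hardy_space p \<theta> = {f. holomorphic_Cn_on f (ball 0 1) \<and> hardy_norm p \<theta> f < top}"

definition hardy_infinity :: "(complex ^ 'n \<Rightarrow> complex) set" where
  "hardy_infinity = {f. holomorphic_Cn_on f (ball 0 1) \<and> bounded (f ` ball 0 1)}"

definition pointwise_multiplier ::
    "real \<Rightarrow> (complex ^ 'n \<Rightarrow> real) \<Rightarrow> (complex ^ 'n \<Rightarrow> complex) \<Rightarrow> bool" where
  "pointwise_multiplier p \<theta> g \<longleftrightarrow>
     (\<forall>f\<in>hardy_space p \<theta>. (\<lambda>z. g z * f z) \<in> hardy_space p \<theta>) \<and>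
     (\<exists>C::real. \<forall>f\<in>hardy_space p \<theta>.
        hardy_norm p \<theta> (\<lambda>z. g z * f z) \<le> ennreal C * hardy_norm p \<theta> f)"

end

theory Submission
  imports Defs
begin

text \<open>If \<open>g\<close> is a multiplier with norm at most \<open>C\<close>, then applying multiplication by \<open>g\<close> repeatedly to
  the constant \<open>1\<close>, which lies in \<open>H\<^sup>p(\<theta>)\<close>, gives
  \<open>\<integral> |g(r\<zeta>)|\<^sup>k\<^sup>p \<theta> d\<sigma> \<le> C\<^sup>k\<^sup>p \<integral> \<theta> d\<sigma>\<close> for all \<open>k\<close>. If \<open>|g(r\<zeta>)| > C\<close> at one point, then \<open>|g| \<ge> C' > C\<close>
  on a relatively open set of the sphere of radius \<open>r\<close>, and letting \<open>k \<rightarrow> \<infinity>\<close> shows that \<open>\<theta>\<close> vanishes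
  almost everywhere on the corresponding open subset of \<open>\<S>\<close>. This is impossible: by the \<open>A\<^sub>p\<close>
  condition, \<open>\<theta>\<close> vanishes almost everywhere on \<open>I\<^sub>z\<close> as soon as it does on some nonempty open
  subset of \<open>I\<^sub>z\<close>, so the largest open null set of \<open>\<theta>\<close> is also closed in the connected sphere.\<close>

section \<open>Surface measure\<close>

lemma space_sphere_measure [simp]: "space sphere_measure = sphere 0 1"
  by (simp add: sphere_measure_def space_scale_measure space_restrict_space)

lemma sgn_measurable_sphere:
  "sgn \<in> measurable (restrict_space lborel (ball (0::'a::euclidean_space) 1 - {0}))
                    (restrict_space borel (sphere 0 1))"
proof (rule measurable_restrict_space2)
  show "sgn \<in> space (restrict_space lborel (ball (0::'a) 1 - {0})) \<rightarrow> sphere 0 1"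
    by (auto simp: space_restrict_space norm_sgn)
  have "sgn = (\<lambda>x::'a. x /\<^sub>R norm x)"
    by (auto simp: sgn_div_norm)
  then show "sgn \<in> borel_measurable (restrict_space lborel (ball (0::'a) 1 - {0}))"
    by (auto intro!: measurable_restrict_space1)
qed

lemma sets_sphere_measure:
  assumes "W \<in> sets (restrict_space borel (sphere 0 1))"
  shows "W \<in> sets sphere_measure"
  using assms unfolding sphere_measure_def by (intro sets_completionI_sets) simp

lemma open_Int_sphere_sets: "open T \<Longrightarrow> T \<inter> sphere 0 1 \<in> sets sphere_measure"
  by (intro sets_sphere_measure) (auto simp: sets_restrict_space)

text \<open>On Borel subsets of the sphere the completion changes no value, so surface measure is
  computed from the volume of the cone over \<open>W\<close>.\<close>

lemma emeasure_sphere_measure: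
  assumes "W \<in> sets (restrict_space borel (sphere (0::'a::euclidean_space) 1))"
  shows "emeasure sphere_measure W =
    of_nat DIM('a) * emeasure lborel {x \<in> ball 0 1 - {0}. sgn x \<in> W}"
proof -
  have "emeasure sphere_measure W = of_nat DIM('a) *
     emeasure (restrict_space lborel (ball 0 1 - {0}))
       (sgn -` W \<inter> space (restrict_space lborel (ball (0::'a) 1 - {0})))"
    unfolding sphere_measure_def using assms
    by (simp add: emeasure_distr[OF sgn_measurable_sphere])
  also have "sgn -` W \<inter> space (restrict_space lborel (ball (0::'a) 1 - {0}))
      = {x \<in> ball 0 1 - {0}. sgn x \<in> W}"
    by (auto simp: space_restrict_space)
  also have "emeasure (restrict_space lborel (ball 0 1 - {0})) {x \<in> ball 0 1 - {0}. sgn x \<in> W}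
     = emeasure lborel {x \<in> ball 0 1 - {0}. sgn x \<in> W}"
    by (rule emeasure_restrict_space) auto
  finally show ?thesis .
qed

lemma emeasure_sphere_measure_finite:
  assumes "W \<in> sets (restrict_space borel (sphere (0::'a::euclidean_space) 1))"
  shows "emeasure sphere_measure W < top"
proof -
  have "emeasure lborel {x \<in> ball (0::'a) 1 - {0}. sgn x \<in> W} \<le> emeasure lborel (ball (0::'a) 1)"
    by (rule emeasure_mono) auto
  also have "\<dots> < top"
    using emeasure_lborel_ball_finite by simp
  finally show ?thesis
    by (simp add: emeasure_sphere_measure[OF assms] ennreal_mult_less_top of_nat_less_top)
qed

text \<open>The cone over a nonempty relatively open set is a nonempty open subset of the ball,
  hence not negligible.\<close>

lemma emeasure_sphere_measure_open_pos:
  assumes "open T" and "T \<inter> sphere (0::'a::euclidean_space) 1 \<noteq> {}"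
  shows "0 < emeasure sphere_measure (T \<inter> sphere 0 1)"
proof -
  define B where "B = {x \<in> ball (0::'a) 1 - {0}. sgn x \<in> T \<inter> sphere 0 1}"
  have "continuous_on (ball (0::'a) 1 - {0}) sgn"
    by (auto intro!: continuous_intros)
  then have "open ((ball 0 1 - {0}) \<inter> sgn -` T)"
    using assms(1) by (intro continuous_open_preimage) auto
  also have "(ball 0 1 - {0}) \<inter> sgn -` T = B"
    by (auto simp: B_def norm_sgn)
  finally have "open B" .
  obtain \<zeta> where \<zeta>: "\<zeta> \<in> T" "norm \<zeta> = 1" using assms(2) by auto
  then have "sgn ((1/2) *\<^sub>R \<zeta>) = \<zeta>"
    by (auto simp: sgn_scaleR sgn_div_norm)
  then have "(1/2) *\<^sub>R \<zeta> \<in> B"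
    using \<zeta> by (auto simp: B_def)
  then have "\<not> negligible B"
    using \<open>open B\<close> open_not_negligible by blast
  then have "emeasure lborel B \<noteq> 0"
    using \<open>open B\<close> by (simp add: negligible_iff_emeasure0)
  then show ?thesis
    using assms(1) unfolding B_def
    by (subst emeasure_sphere_measure) (auto simp: sets_restrict_space zero_less_iff_neq_zero)
qed

text \<open>Scaling keeps the sigma-algebra and completion only enlarges it, so Borel measurability
  on the sphere carries over.\<close>

lemma continuous_on_sphere_measurable:
  fixes h :: "'a::euclidean_space \<Rightarrow> 'b::topological_space"
  assumes "continuous_on (sphere 0 1) h"
  shows "h \<in> borel_measurable sphere_measure"
proof -
  have "h \<in> borel_measurable (restrict_space borel (sphere 0 1))"
    by (rule borel_measurable_continuous_on_restrict[OF assms])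
  then show ?thesis
    unfolding sphere_measure_def
    by (intro measurable_completion) (simp add: measurable_def space_scale_measure space_restrict_space)
qed

section \<open>Extended real powers\<close>

lemma ennreal_powr_ennreal:
  assumes "0 < a" "0 \<le> x"
  shows "ennreal_powr (ennreal x) a = ennreal (x powr a)"
  using assms by (auto simp: ennreal_powr_def)

lemma ennreal_powr_top: "0 < a \<Longrightarrow> ennreal_powr top a = top"
  by (auto simp: ennreal_powr_def)

lemma ennreal_powr_eq_0_iff: "0 < a \<Longrightarrow> ennreal_powr x a = 0 \<longleftrightarrow> x = 0"
  by (cases x rule: ennreal_cases) (auto simp: ennreal_powr_ennreal ennreal_powr_top)

lemma ennreal_powr_mono:
  assumes "0 < a" "x \<le> y"
  shows "ennreal_powr x a \<le> ennreal_powr y a"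
  using assms
  by (cases x rule: ennreal_cases; cases y rule: ennreal_cases)
     (auto simp: ennreal_powr_ennreal ennreal_powr_top top_unique intro!: ennreal_leI powr_mono2)

lemma ennreal_powr_cmult:
  assumes "0 < a" "0 < c"
  shows "ennreal_powr (ennreal c * x) a = ennreal (c powr a) * ennreal_powr x a"
  using assms
  by (cases x rule: ennreal_cases)
     (auto simp: ennreal_powr_ennreal ennreal_powr_top powr_mult ennreal_mult_top ennreal_mult[symmetric])

text \<open>Leads from a bound on \<open>hardy_norm\<close> back to one on \<open>hardy_sup\<close>;
  the finite right-hand side rules out \<open>x = top\<close>.\<close>

lemma le_of_ennreal_powr_le:
  assumes "0 < p" "0 \<le> c" and le: "ennreal_powr x (1 / p) \<le> ennreal c"
  shows "x \<le> ennreal (c powr p)"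
proof (cases x rule: ennreal_cases)
  case (real r)
  then have "r powr (1 / p) \<le> c"
    using assms by (simp add: ennreal_powr_ennreal ennreal_le_iff)
  then have "(r powr (1 / p)) powr p \<le> c powr p"
    using assms by (intro powr_mono2) auto
  then show ?thesis
    using real assms by (simp add: powr_powr ennreal_leI)
next
  case top
  then show ?thesis using assms by (simp add: ennreal_powr_top top_unique)
qed

section \<open>The support of a weight\<close>

lemma continuous_on_herm_left: "continuous_on S (\<lambda>z. herm z w)"
  unfolding herm_def by (intro continuous_intros)

text \<open>Puts a point of the sphere into the nonisotropic neighbourhood centred at it.\<close>

lemma herm_self: "norm z = 1 \<Longrightarrow> herm z z = 1"
proof -
  assume z: "norm z = 1"
  have "herm z z = (\<Sum>j\<in>UNIV. complex_of_real ((norm (z $ j))\<^sup>2))"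
    unfolding herm_def by (intro sum.cong) (auto simp: complex_norm_square[symmetric])
  also have "\<dots> = complex_of_real ((norm z)\<^sup>2)"
    by (simp add: norm_vec_def L2_set_def real_sqrt_pow2 sum_nonneg)
  finally show ?thesis using z by simp
qed

text \<open>A negative power of \<open>\<theta>\<close> is infinite where \<open>\<theta>\<close> vanishes, so the second factor of the
  \<open>A\<^sub>p\<close> product is infinite, and the first one has to be \<open>0\<close>.\<close>

lemma Ap_weight_null_nonisotropic_ball:
  fixes \<theta> :: "complex ^ 'n \<Rightarrow> real"
  assumes p: "1 < p" and A: "Ap_weight p \<theta>"
    and z: "z \<in> ball 0 1 - {0}"
    and T: "open T" "nonisotropic_ball z = T \<inter> sphere 0 1"
    and U: "open U" "U \<inter> T \<inter> sphere 0 1 \<noteq> {}"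
    and null: "AE \<eta> in sphere_measure. \<eta> \<in> U \<longrightarrow> \<theta> \<eta> = 0"
  shows "AE \<eta> in sphere_measure. \<eta> \<in> T \<longrightarrow> \<theta> \<eta> = 0"
proof -
  define q where "q = conj_exponent p"
  have q: "0 < q" using p by (simp add: q_def conj_exponent_def)
  define I where "I = T \<inter> sphere 0 1"
  define \<phi> where "\<phi> \<eta> = ennreal_powr (ennreal (\<theta> \<eta>)) (- q / p)" for \<eta>
  have nonneg: "\<And>\<eta>. \<eta> \<in> sphere 0 1 \<Longrightarrow> 0 \<le> \<theta> \<eta>"
    and int: "integrable sphere_measure \<theta>"
    using A by (auto simp: Ap_weight_def)
  have [measurable]: "\<theta> \<in> borel_measurable sphere_measure" using int by auto
  have I [measurable]: "I \<in> sets sphere_measure"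
    unfolding I_def using T by (intro open_Int_sphere_sets)
  have Ifin: "emeasure sphere_measure I < top"
    unfolding I_def by (rule emeasure_sphere_measure_finite) (auto simp: sets_restrict_space T)
  have UI: "0 < emeasure sphere_measure (U \<inter> T \<inter> sphere 0 1)"
    using T U by (intro emeasure_sphere_measure_open_pos) auto
  have UIs: "U \<inter> T \<inter> sphere 0 1 \<in> sets sphere_measure"
    using T U by (intro open_Int_sphere_sets) auto
  have "(\<integral>\<^sup>+\<eta>. top * indicator (U \<inter> T \<inter> sphere 0 1) \<eta> \<partial>sphere_measure)
      \<le> (\<integral>\<^sup>+\<eta>\<in>I. \<phi> \<eta> \<partial>sphere_measure)"
  proof (rule nn_integral_mono_AE)
    show "AE \<eta> in sphere_measure. top * indicator (U \<inter> T \<inter> sphere 0 1) \<eta> \<le> \<phi> \<eta> * indicator I \<eta>"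
      using null
    proof eventually_elim
      case (elim \<eta>)
      then show ?case
        using p q by (auto simp: \<phi>_def I_def indicator_def ennreal_powr_def)
    qed
  qed
  also have "(\<integral>\<^sup>+\<eta>. top * indicator (U \<inter> T \<inter> sphere 0 1) \<eta> \<partial>sphere_measure) = top"
    using UI by (subst nn_integral_cmult_indicator[OF UIs]) (simp add: ennreal_top_mult)
  finally have "(\<integral>\<^sup>+\<eta>\<in>I. \<phi> \<eta> \<partial>sphere_measure) = top"
    by (simp add: top_unique)
  \<comment> \<open>\<open>Ifin\<close> matters here: in \<open>ennreal\<close>, dividing by
    \<open>top\<close> gives \<open>0\<close>, even from \<open>top\<close>.\<close>
  then have "sphere_average I \<phi> = top"
    using Ifin by (simp add: sphere_average_def ennreal_top_divide)
  then have B: "ennreal_powr (sphere_average I \<phi>) (1 / q) = top"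
    using q by (simp add: ennreal_powr_top)
  have "ennreal_powr (sphere_average I (\<lambda>\<eta>. ennreal (\<theta> \<eta>))) (1 / p) *
        ennreal_powr (sphere_average I \<phi>) (1 / q) < top"
    using A unfolding Ap_weight_def \<phi>_def q_def I_def T(2)[symmetric]
    by (elim conjE) (rule le_less_trans[OF SUP_upper[OF z]])
  \<comment> \<open>A product with \<open>top\<close> is finite only if the other factor is
    \<open>0\<close>.\<close>
  then have "ennreal_powr (sphere_average I (\<lambda>\<eta>. ennreal (\<theta> \<eta>))) (1 / p) = 0"
    unfolding B by (auto simp: ennreal_mult_top split: if_splits)
  then have "sphere_average I (\<lambda>\<eta>. ennreal (\<theta> \<eta>)) = 0"
    using p by (simp add: ennreal_powr_eq_0_iff)
  \<comment> \<open>By \<open>Ifin\<close>, the quotient can vanish only through its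
    numerator.\<close>
  then have "(\<integral>\<^sup>+\<eta>\<in>I. ennreal (\<theta> \<eta>) \<partial>sphere_measure) = 0"
    using Ifin by (auto simp: sphere_average_def)
  then have "AE \<eta> in sphere_measure. ennreal (\<theta> \<eta>) * indicator I \<eta> = 0"
    by (subst (asm) nn_integral_0_iff_AE) auto
  then show ?thesis
    using AE_space
  proof eventually_elim
    case (elim \<eta>)
    then show ?case using nonneg[of \<eta>] by (auto simp: I_def ennreal_eq_0_iff split: if_splits)
  qed
qed

text \<open>Nonisotropic balls of one fixed size suffice: the largest open null set absorbs every
  such ball that it meets, and connectedness spreads it over the sphere.\<close>

lemma Ap_weight_support:
  fixes \<theta> :: "complex ^ 'n \<Rightarrow> real"
  assumes p: "1 < p" and A: "Ap_weight p \<theta>"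
    and T: "open T" "T \<inter> sphere 0 1 \<noteq> {}"
  shows "\<not> (AE \<eta> in sphere_measure. \<eta> \<in> T \<longrightarrow> \<theta> \<eta> = 0)"
proof
  assume nullT: "AE \<eta> in sphere_measure. \<eta> \<in> T \<longrightarrow> \<theta> \<eta> = 0"
  define F where "F = {W. open W \<and> (AE \<eta> in sphere_measure. \<eta> \<in> W \<longrightarrow> \<theta> \<eta> = 0)}"
  \<comment> \<open>The union of \<open>F\<close> may be uncountable; a countable subfamily with the
    same union keeps the exceptional set null.\<close>
  obtain F' where F': "F' \<subseteq> F" "countable F'" "\<Union>F' = \<Union>F"
    using Lindelof[of F] by (auto simp: F_def)
  have "AE \<eta> in sphere_measure. \<forall>W\<in>F'. \<eta> \<in> W \<longrightarrow> \<theta> \<eta> = 0"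
    using F' by (subst AE_ball_countable) (auto simp: F_def)
  then have nullF: "AE \<eta> in sphere_measure. \<eta> \<in> \<Union>F \<longrightarrow> \<theta> \<eta> = 0"
    unfolding F'(3)[symmetric] by eventually_elim auto
  have oF: "open (\<Union>F)" by (auto simp: F_def)
  \<comment> \<open>The radius is \<open>1 - (1/2)\<^sup>2\<close>, so on the sphere
    \<open>N \<zeta>\<close> is the nonisotropic ball of the point
    \<open>(1/2) *\<^sub>R \<zeta>\<close>.\<close>
  define N where "N \<zeta> = {\<eta>. norm (1 - herm \<eta> \<zeta>) < 3 / 4}" for \<zeta> :: "complex ^ 'n"
  have oN: "open (N \<zeta>)" for \<zeta>
    unfolding N_def by (intro open_Collect_less continuous_intros continuous_on_herm_left)
  have self: "\<zeta> \<in> N \<zeta>" if "\<zeta> \<in> sphere 0 1" for \<zeta>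
    using that by (simp add: N_def herm_self)
  have sub: "N \<zeta> \<subseteq> \<Union>F" if \<zeta>: "\<zeta> \<in> sphere 0 1" and ne: "\<Union>F \<inter> N \<zeta> \<inter> sphere 0 1 \<noteq> {}" for \<zeta>
  proof -
    have "norm \<zeta> = 1" using \<zeta> by simp
    then have "sgn ((1/2) *\<^sub>R \<zeta>) = \<zeta>"
      by (auto simp: sgn_scaleR sgn_div_norm)
    then have "nonisotropic_ball ((1/2) *\<^sub>R \<zeta>) = N \<zeta> \<inter> sphere 0 1"
      using \<open>norm \<zeta> = 1\<close> by (auto simp: nonisotropic_ball_def N_def power2_eq_square)
    moreover have "(1/2) *\<^sub>R \<zeta> \<in> ball 0 1 - {0}"
      using \<open>norm \<zeta> = 1\<close> by auto
    ultimately have "AE \<eta> in sphere_measure. \<eta> \<in> N \<zeta> \<longrightarrow> \<theta> \<eta> = 0"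
      using Ap_weight_null_nonisotropic_ball[OF p A _ oN _ oF ne nullF] by blast
    then have "N \<zeta> \<in> F" using oN by (auto simp: F_def)
    then show ?thesis by auto
  qed
  \<comment> \<open>On the sphere \<open>V\<close> is disjoint from \<open>\<Union>F\<close>: if
    some \<open>N \<zeta>\<close> met \<open>\<Union>F\<close> there, \<open>sub\<close> would put
    its centre into \<open>\<Union>F\<close>.\<close>
  define V where "V = (\<Union>\<zeta>\<in>sphere 0 1 - \<Union>F. N \<zeta>)"
  \<comment> \<open>The real dimension is twice \<open>CARD('n)\<close>, hence at least 2.\<close>
  have "connected (sphere (0::complex ^ 'n) 1)"
    by (rule connected_sphere) (simp add: Suc_leI)
  moreover have "open V" using oN by (auto simp: V_def)
  moreover have "sphere 0 1 \<subseteq> \<Union>F \<union> V" using self by (auto simp: V_def)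
  moreover have "\<Union>F \<inter> V \<inter> sphere 0 1 = {}"
    using sub self unfolding V_def by blast
  ultimately have "\<Union>F \<inter> sphere 0 1 = {} \<or> V \<inter> sphere 0 1 = {}"
    using oF by (intro connectedD) auto
  moreover have "T \<subseteq> \<Union>F" using nullT T by (auto simp: F_def)
  ultimately have "V \<inter> sphere 0 1 = {}" using T by auto
  then have all: "sphere 0 1 \<subseteq> \<Union>F"
    using \<open>sphere 0 1 \<subseteq> \<Union>F \<union> V\<close> by blast
  have "AE \<eta> in sphere_measure. \<theta> \<eta> = 0"
    using nullF AE_space
  proof eventually_elim
    case (elim \<eta>)
    then show ?case using subsetD[OF all, of \<eta>] by simp
  qed
  then show False using A by (simp add: Ap_weight_def)
qed

section \<open>Multipliers\<close>

lemma holomorphic_Cn_on_const: "holomorphic_Cn_on (\<lambda>z. c) U"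
  unfolding holomorphic_Cn_on_def by (auto intro!: exI[of _ "\<lambda>_. 0"])

lemma holomorphic_Cn_on_mult:
  assumes "holomorphic_Cn_on f U" "holomorphic_Cn_on g U"
  shows "holomorphic_Cn_on (\<lambda>z. f z * g z) U"
  unfolding holomorphic_Cn_on_def
proof
  fix z assume "z \<in> U"
  obtain D where D: "(f has_derivative D) (at z)" "\<And>c v. D (c *s v) = c * D v"
    using assms(1) \<open>z \<in> U\<close> unfolding holomorphic_Cn_on_def by blast
  obtain E where E: "(g has_derivative E) (at z)" "\<And>c v. E (c *s v) = c * E v"
    using assms(2) \<open>z \<in> U\<close> unfolding holomorphic_Cn_on_def by blast
  have "((\<lambda>z. f z * g z) has_derivative (\<lambda>h. f z * E h + D h * g z)) (at z)"
    by (rule has_derivative_mult[OF D(1) E(1)])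
  moreover have "\<forall>c v. f z * E (c *s v) + D (c *s v) * g z = c * (f z * E v + D v * g z)"
    by (auto simp: D(2) E(2) algebra_simps)
  ultimately show "\<exists>D. ((\<lambda>z. f z * g z) has_derivative D) (at z) \<and> (\<forall>c v. D (c *s v) = c * D v)"
    by blast
qed

lemma holomorphic_Cn_on_dilation_continuous:
  fixes f :: "complex ^ 'n \<Rightarrow> complex"
  assumes "holomorphic_Cn_on f (ball 0 1)" "0 < r" "r < 1"
  shows "continuous_on (sphere 0 1) (\<lambda>\<zeta>. f (r *\<^sub>R \<zeta>))"
proof -
  have "continuous_on (ball 0 1) f"
    using assms(1) unfolding holomorphic_Cn_on_def
    by (auto intro!: continuous_at_imp_continuous_on dest!: has_derivative_continuous bspec)
  then show ?thesis
    using assms(2,3) by (rule_tac continuous_on_compose2) (auto intro!: continuous_intros)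
qed

section \<open>Bounded holomorphic functions are multipliers\<close>

lemma hardy_sup_mult_le:
  fixes f g :: "complex ^ 'n \<Rightarrow> complex"
  assumes p: "1 < p" and A: "Ap_weight p \<theta>" and f: "holomorphic_Cn_on f (ball 0 1)"
    and C: "0 < C" "\<And>z. z \<in> ball 0 1 \<Longrightarrow> norm (g z) \<le> C"
  shows "hardy_sup p \<theta> (\<lambda>z. g z * f z) \<le> ennreal (C powr p) * hardy_sup p \<theta> f"
  unfolding hardy_sup_def
proof (rule SUP_least)
  fix r :: real assume r: "r \<in> {0<..<1}"
  have nonneg: "\<And>\<eta>. \<eta> \<in> sphere 0 1 \<Longrightarrow> 0 \<le> \<theta> \<eta>"
    and [measurable]: "\<theta> \<in> borel_measurable sphere_measure"
    using A by (auto simp: Ap_weight_def)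
  have [measurable]: "(\<lambda>\<zeta>. f (r *\<^sub>R \<zeta>)) \<in> borel_measurable sphere_measure"
    using r f by (intro continuous_on_sphere_measurable holomorphic_Cn_on_dilation_continuous) auto
  have "(\<integral>\<^sup>+\<zeta>. ennreal (norm (g (r *\<^sub>R \<zeta>) * f (r *\<^sub>R \<zeta>)) powr p * \<theta> \<zeta>) \<partial>sphere_measure)
     \<le> (\<integral>\<^sup>+\<zeta>. ennreal (C powr p) * ennreal (norm (f (r *\<^sub>R \<zeta>)) powr p * \<theta> \<zeta>) \<partial>sphere_measure)"
  proof (rule nn_integral_mono)
    fix \<zeta> :: "complex ^ 'n" assume "\<zeta> \<in> space sphere_measure"
    then have \<zeta>: "\<zeta> \<in> sphere 0 1" by simp
    then have "r *\<^sub>R \<zeta> \<in> ball 0 1" using r by simp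
    then have "norm (g (r *\<^sub>R \<zeta>)) powr p \<le> C powr p"
      using C p by (intro powr_mono2) auto
    then have "norm (g (r *\<^sub>R \<zeta>) * f (r *\<^sub>R \<zeta>)) powr p * \<theta> \<zeta>
        \<le> C powr p * (norm (f (r *\<^sub>R \<zeta>)) powr p * \<theta> \<zeta>)"
      using nonneg[OF \<zeta>]
      by (simp add: norm_mult powr_mult mult.assoc mult_right_mono)
    then show "ennreal (norm (g (r *\<^sub>R \<zeta>) * f (r *\<^sub>R \<zeta>)) powr p * \<theta> \<zeta>)
        \<le> ennreal (C powr p) * ennreal (norm (f (r *\<^sub>R \<zeta>)) powr p * \<theta> \<zeta>)"
      using nonneg[OF \<zeta>] by (simp add: ennreal_mult[symmetric] ennreal_leI)
  qed
  also have "\<dots> = ennreal (C powr p) * (\<integral>\<^sup>+\<zeta>. ennreal (norm (f (r *\<^sub>R \<zeta>)) powr p * \<theta> \<zeta>) \<partial>sphere_measure)"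
    by (rule nn_integral_cmult) measurable
  also have "\<dots> \<le> ennreal (C powr p) *
      (SUP r\<in>{0<..<1}. \<integral>\<^sup>+\<zeta>. ennreal (norm (f (r *\<^sub>R \<zeta>)) powr p * \<theta> \<zeta>) \<partial>sphere_measure)"
    using r by (intro mult_left_mono SUP_upper) auto
  finally show "(\<integral>\<^sup>+\<zeta>. ennreal (norm (g (r *\<^sub>R \<zeta>) * f (r *\<^sub>R \<zeta>)) powr p * \<theta> \<zeta>) \<partial>sphere_measure)
     \<le> ennreal (C powr p) *
      (SUP r\<in>{0<..<1}. \<integral>\<^sup>+\<zeta>. ennreal (norm (f (r *\<^sub>R \<zeta>)) powr p * \<theta> \<zeta>) \<partial>sphere_measure)" .
qed

text \<open>One estimate gives both the norm bound and membership: the power \<open>1 / p\<close>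
  turns the factor \<open>C powr p\<close> into \<open>C\<close>, and a finite norm times
  \<open>C\<close> stays finite.\<close>

lemma hardy_infinity_imp_multiplier:
  fixes \<theta> :: "complex ^ 'n \<Rightarrow> real"
  assumes p: "1 < p" and A: "Ap_weight p \<theta>" and g: "g \<in> hardy_infinity"
  shows "pointwise_multiplier p \<theta> g"
proof -
  obtain C where C: "0 < C" "\<And>z. z \<in> ball 0 1 \<Longrightarrow> norm (g z) \<le> C"
    using g by (auto simp: hardy_infinity_def bounded_pos)
  have bd: "hardy_norm p \<theta> (\<lambda>z. g z * f z) \<le> ennreal C * hardy_norm p \<theta> f"
    if "f \<in> hardy_space p \<theta>" for f
  proof -
    have "hardy_norm p \<theta> (\<lambda>z. g z * f z)
        \<le> ennreal_powr (ennreal (C powr p) * hardy_sup p \<theta> f) (1 / p)"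
      unfolding hardy_norm_def using that p A C
      by (intro ennreal_powr_mono hardy_sup_mult_le) (auto simp: hardy_space_def)
    also have "\<dots> = ennreal C * hardy_norm p \<theta> f"
      using p C by (simp add: ennreal_powr_cmult hardy_norm_def powr_powr)
    finally show ?thesis .
  qed
  moreover have "(\<lambda>z. g z * f z) \<in> hardy_space p \<theta>" if f: "f \<in> hardy_space p \<theta>" for f
    using f g bd[OF f] holomorphic_Cn_on_mult[of g "ball 0 1" f]
    by (auto simp: hardy_space_def hardy_infinity_def ennreal_mult_less_top intro: le_less_trans)
  ultimately show ?thesis
    unfolding pointwise_multiplier_def by blast
qed

section \<open>Multipliers are bounded\<close>

lemma hardy_sup_one:
  assumes "Ap_weight p \<theta>"
  shows "hardy_sup p \<theta> (\<lambda>_. 1) = ennreal (integral\<^sup>L sphere_measure \<theta>)"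
proof -
  have "(\<integral>\<^sup>+\<zeta>. ennreal (\<theta> \<zeta>) \<partial>sphere_measure) = ennreal (integral\<^sup>L sphere_measure \<theta>)"
    using assms by (intro nn_integral_eq_integral) (auto simp: Ap_weight_def)
  then show ?thesis
    by (simp add: hardy_sup_def)
qed

lemma multiplier_imp_hardy_infinity:
  fixes \<theta> :: "complex ^ 'n \<Rightarrow> real"
  assumes p: "1 < p" and A: "Ap_weight p \<theta>" and g: "holomorphic_Cn_on g (ball 0 1)"
    and mult: "pointwise_multiplier p \<theta> g"
  shows "g \<in> hardy_infinity"
proof -
  have nonneg: "\<And>\<eta>. \<eta> \<in> sphere 0 1 \<Longrightarrow> 0 \<le> \<theta> \<eta>"
    and [measurable]: "\<theta> \<in> borel_measurable sphere_measure"
    using A by (auto simp: Ap_weight_def)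
  define M where "M = integral\<^sup>L sphere_measure \<theta>"
  have M: "0 \<le> M"
    unfolding M_def using nonneg by (intro integral_nonneg_AE AE_I2) auto
  have one: "hardy_norm p \<theta> (\<lambda>_. 1) = ennreal (M powr (1 / p))"
    using p M by (simp add: hardy_norm_def hardy_sup_one[OF A] M_def[symmetric] ennreal_powr_ennreal)
  obtain C0 :: real where C0: "\<And>f. f \<in> hardy_space p \<theta> \<Longrightarrow>
      hardy_norm p \<theta> (\<lambda>z. g z * f z) \<le> ennreal C0 * hardy_norm p \<theta> f"
    using mult unfolding pointwise_multiplier_def by blast
  \<comment> \<open>\<open>C0\<close> may be zero or negative; the maximum makes \<open>C\<close>
    positive, so that its powers are monotone and can be divided by.\<close>
  define C where "C = max C0 1"
  have C: "1 \<le> C" by (simp add: C_def)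
  \<comment> \<open>Membership is carried along in the induction because \<open>C0\<close> only
    bounds products with members of the space.\<close>
  have pow: "(\<lambda>z. g z ^ k) \<in> hardy_space p \<theta> \<and>
      hardy_norm p \<theta> (\<lambda>z. g z ^ k) \<le> ennreal (C ^ k * M powr (1 / p))" for k
  proof (induction k)
    case 0
    then show ?case using one by (simp add: hardy_space_def holomorphic_Cn_on_const)
  next
    case (Suc k)
    have "hardy_norm p \<theta> (\<lambda>z. g z * g z ^ k) \<le> ennreal C0 * hardy_norm p \<theta> (\<lambda>z. g z ^ k)"
      using Suc by (intro C0) auto
    also have "\<dots> \<le> ennreal C * ennreal (C ^ k * M powr (1 / p))"
      using Suc by (intro mult_mono ennreal_leI) (auto simp: C_def)
    also have "\<dots> = ennreal (C ^ Suc k * M powr (1 / p))"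
      using C by (simp add: ennreal_mult[symmetric] mult.assoc)
    finally show ?case
      using Suc mult unfolding pointwise_multiplier_def by simp
  qed
  have sup: "hardy_sup p \<theta> (\<lambda>z. g z ^ k) \<le> ennreal ((C powr p) ^ k * M)" for k
  proof -
    have "hardy_sup p \<theta> (\<lambda>z. g z ^ k) \<le> ennreal ((C ^ k * M powr (1 / p)) powr p)"
      using p C M pow[of k] unfolding hardy_norm_def
      by (intro le_of_ennreal_powr_le) auto
    also have "(C ^ k * M powr (1 / p)) powr p = (C powr p) ^ k * M"
      using p C M by (simp add: powr_mult powr_powr powr_realpow[symmetric] mult.commute)
    finally show ?thesis .
  qed
  have sphere_le: "norm (g (r *\<^sub>R \<zeta>)) \<le> C" if r: "0 < r" "r < 1" and \<zeta>: "\<zeta> \<in> sphere 0 1" for r \<zeta>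
  proof (rule ccontr)
    assume "\<not> norm (g (r *\<^sub>R \<zeta>)) \<le> C"
    \<comment> \<open>A constant strictly between leaves a ratio \<open>C' / C\<close> above 1,
      whose powers will beat the fixed mass \<open>M\<close>.\<close>
    then obtain C' where C': "C < C'" "C' < norm (g (r *\<^sub>R \<zeta>))"
      using dense[of C "norm (g (r *\<^sub>R \<zeta>))"] by auto
    have cont: "continuous_on (sphere 0 1) (\<lambda>\<zeta>. norm (g (r *\<^sub>R \<zeta>)))"
      using holomorphic_Cn_on_dilation_continuous[OF g r] by (intro continuous_intros)
    \<comment> \<open>The set where \<open>|g(r\<eta>)| > C'\<close> is relatively open, so
      \<open>Ap_weight_support\<close> gives it positive \<open>\<theta>\<close>-mass
      \<open>m\<close>.\<close>
    obtain T where T: "open T"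
      "T \<inter> sphere 0 1 = (\<lambda>\<zeta>. norm (g (r *\<^sub>R \<zeta>))) -` {C'<..} \<inter> sphere 0 1"
      using cont[unfolded continuous_on_open_invariant, rule_format, of "{C'<..}"] by auto
    have "\<zeta> \<in> T" using T(2) \<zeta> C' by blast
    define W where "W = T \<inter> sphere 0 1"
    have [measurable]: "W \<in> sets sphere_measure"
      unfolding W_def using T(1) by (rule open_Int_sphere_sets)
    define m where "m = (\<integral>\<^sup>+\<eta>\<in>W. ennreal (\<theta> \<eta>) \<partial>sphere_measure)"
    have "m \<noteq> 0"
    proof
      assume "m = 0"
      then have "AE \<eta> in sphere_measure. ennreal (\<theta> \<eta>) * indicator W \<eta> = 0"
        unfolding m_def by (subst (asm) nn_integral_0_iff_AE) auto
      then have "AE \<eta> in sphere_measure. \<eta> \<in> T \<longrightarrow> \<theta> \<eta> = 0"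
        using AE_space
      proof eventually_elim
        case (elim \<eta>)
        then show ?case using nonneg[of \<eta>] by (auto simp: W_def ennreal_eq_0_iff split: if_splits)
      qed
      then show False
        using Ap_weight_support[OF p A T(1)] \<open>\<zeta> \<in> T\<close> \<zeta> by blast
    qed
    \<comment> \<open>As in Chebyshev's inequality, the integral is restricted to \<open>W\<close>,
      where \<open>|g|\<^sup>k\<close> is at least \<open>C' ^ k\<close>.\<close>
    have le: "ennreal ((C' powr p) ^ k) * m \<le> ennreal ((C powr p) ^ k * M)" for k
    proof -
      have "ennreal ((C' powr p) ^ k) * m
          = (\<integral>\<^sup>+\<eta>. ennreal ((C' powr p) ^ k) * (ennreal (\<theta> \<eta>) * indicator W \<eta>) \<partial>sphere_measure)"
        unfolding m_def by (rule nn_integral_cmult[symmetric]) measurable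
      also have "\<dots> \<le> (\<integral>\<^sup>+\<eta>. ennreal (norm (g (r *\<^sub>R \<eta>) ^ k) powr p * \<theta> \<eta>) \<partial>sphere_measure)"
      proof (rule nn_integral_mono)
        fix \<eta> :: "complex ^ 'n" assume "\<eta> \<in> space sphere_measure"
        then have \<eta>: "\<eta> \<in> sphere 0 1" by simp
        show "ennreal ((C' powr p) ^ k) * (ennreal (\<theta> \<eta>) * indicator W \<eta>)
            \<le> ennreal (norm (g (r *\<^sub>R \<eta>) ^ k) powr p * \<theta> \<eta>)"
        proof (cases "\<eta> \<in> W")
          case True
          then have "C' < norm (g (r *\<^sub>R \<eta>))" using T(2) by (auto simp: W_def)
          then have "C' ^ k \<le> norm (g (r *\<^sub>R \<eta>)) ^ k"
            using C C' by (intro power_mono) auto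
          then have "(C' ^ k) powr p \<le> norm (g (r *\<^sub>R \<eta>) ^ k) powr p"
            using C C' p by (intro powr_mono2) (auto simp: norm_power)
          moreover have "(C' ^ k) powr p = (C' powr p) ^ k"
            using C C' p by (simp add: powr_powr powr_realpow[symmetric] mult.commute)
          ultimately have "(C' powr p) ^ k * \<theta> \<eta> \<le> norm (g (r *\<^sub>R \<eta>) ^ k) powr p * \<theta> \<eta>"
            using nonneg[OF \<eta>] by (intro mult_right_mono) auto
          then show ?thesis
            using True nonneg[OF \<eta>] by (simp add: ennreal_mult[symmetric] ennreal_leI)
        qed auto
      qed
      also have "\<dots> \<le> hardy_sup p \<theta> (\<lambda>z. g z ^ k)"
        unfolding hardy_sup_def using r by (intro SUP_upper) auto
      also have "\<dots> \<le> ennreal ((C powr p) ^ k * M)" by (rule sup)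
      finally show ?thesis .
    qed
    \<comment> \<open>For \<open>k = 0\<close> the estimate reads
      \<open>m \<le> ennreal M\<close>.\<close>
    from le[of 0] have "m < top" by (auto intro: le_less_trans)
    then obtain m' where m': "m = ennreal m'" "0 < m'"
      using \<open>m \<noteq> 0\<close> by (cases m rule: ennreal_cases) (auto simp: order_less_le)
    have lt: "C powr p < C' powr p" and pos: "0 < C powr p"
      using C C' p by (auto intro: powr_less_mono2)
    \<comment> \<open>Dividing by \<open>(C powr p) ^ k\<close> turns \<open>le\<close> into
      \<open>q ^ k * m' \<le> M\<close>, which fails for large \<open>k\<close>.\<close>
    define q where "q = C' powr p / C powr p"
    have "1 < q" using lt pos by (simp add: q_def)
    then obtain k where k: "M / m' < q ^ k"
      using real_arch_pow by blast
    have "(C' powr p) ^ k * m' \<le> (C powr p) ^ k * M"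
      using le[of k] m' M by (simp add: ennreal_mult[symmetric] ennreal_le_iff)
    then have "q ^ k * m' \<le> M"
      using pos by (simp add: q_def power_divide field_simps)
    then show False
      using k m' by (simp add: field_simps)
  qed
  \<comment> \<open>The origin lies on no sphere of radius \<open>r > 0\<close>, so the value there
    is added to the bound by hand.\<close>
  have "norm (g z) \<le> max C (norm (g 0))" if "z \<in> ball 0 1" for z
  proof (cases "z = 0")
    case False
    then have "norm (g (norm z *\<^sub>R sgn z)) \<le> C"
      using that by (intro sphere_le) (auto simp: norm_sgn)
    then show ?thesis
      using False by (simp add: sgn_div_norm)
  qed simp
  then have "bounded (g ` ball 0 1)"
    unfolding bounded_iff by (intro exI[of _ "max C (norm (g 0))"]) blast
  then show ?thesis
    using g by (simp add: hardy_infinity_def)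
qed

theorem proposition3p1:
  fixes p :: real
    and \<theta> :: "complex ^ 'n \<Rightarrow> real"
    and g :: "complex ^ 'n \<Rightarrow> complex"
  assumes "CARD('n) > 1"
    and "1 < p"
    and "Ap_weight p \<theta>"
    and "holomorphic_Cn_on g (ball 0 1)"
  shows "pointwise_multiplier p \<theta> g \<longleftrightarrow> g \<in> hardy_infinity"
  using assms multiplier_imp_hardy_infinity hardy_infinity_imp_multiplier by blast

end
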